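(* Let $R$ be a commutative ring with nonzero identity, let $U(R)$ be its set of units, and let $S\subseteq U(R)$ be a multiplicative set. Let $M$ be an $R$-module and $N\leq M$ a submodule. Then $N$ is $u$-$S$-essential in $M$ if and only if $N$ is essential in $M$.
   Context: A multiplicative subset $S$ of $R$ satisfies $1\in S$, $0\notin S$, and $s_1s_2\in S$ for all $s_1,s_2\in S$. All modules are unitary. An $R$-module $X$ is $u$-$S$-torsion if there exists $s\in S$ with $sX=0$. A submodule $N$ of $M$ is $u$-$S$-essential in $M$ if for every submodule $L$ of $M$, $N\cap L$ being $u$-$S$-torsion implies that $L$ is $u$-$S$-torsion. A submodule $N$ of $M$ is essential in $M$ if for every submodule $L$ of $M$, $N\cap L=0$ implies $L=0$. *)

theory Defs
  imports "HOL-Algebra.Module"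
begin

definition multiplicative_subset :: "('a, 'r) ring_scheme \<Rightarrow> 'a set \<Rightarrow> bool" where
  "multiplicative_subset R S \<longleftrightarrow> submonoid S R \<and> \<zero>\<^bsub>R\<^esub> \<notin> S"

definition u_S_torsion :: "'a set \<Rightarrow> ('a, 'b, 'm) module_scheme \<Rightarrow> bool" where
  "u_S_torsion S X \<longleftrightarrow> (\<exists>s\<in>S. \<forall>x\<in>carrier X. s \<odot>\<^bsub>X\<^esub> x = \<zero>\<^bsub>X\<^esub>)"

(* A submodule L of M, regarded as a module in its own right, is M\<lparr>carrier := L\<rparr>. *)
definition u_S_essential ::
    "('a, 'r) ring_scheme \<Rightarrow> 'a set \<Rightarrow> 'b set \<Rightarrow> ('a, 'b, 'm) module_scheme \<Rightarrow> bool" where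
  "u_S_essential R S N M \<longleftrightarrow> submodule N R M \<and>
     (\<forall>L. submodule L R M \<longrightarrow>
        u_S_torsion S (M\<lparr>carrier := N \<inter> L\<rparr>) \<longrightarrow> u_S_torsion S (M\<lparr>carrier := L\<rparr>))"

definition essential_submodule ::
    "('a, 'r) ring_scheme \<Rightarrow> 'b set \<Rightarrow> ('a, 'b, 'm) module_scheme \<Rightarrow> bool" where
  "essential_submodule R N M \<longleftrightarrow> submodule N R M \<and>
     (\<forall>L. submodule L R M \<longrightarrow> N \<inter> L = {\<zero>\<^bsub>M\<^esub>} \<longrightarrow> L = {\<zero>\<^bsub>M\<^esub>})"

end

theory Submission
  imports Defs
begin

text \<open>A unit acts injectively on a module, so if some s in S, a unit, kills X, then X is zero;
  conversely any s in S kills the zero module. Hence for \<open>S \<subseteq> Units R\<close> being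
  u-S-torsion is the same as being zero (\<open>u_S_torsion_iff_zero\<close>). Rewriting both
  torsion conditions in u-S-essentiality this way gives ordinary essentiality.\<close>

lemma (in module) Units_smult_eq_zeroD:
  assumes s: "s \<in> Units R" and x: "x \<in> carrier M" and eq: "s \<odot>\<^bsub>M\<^esub> x = \<zero>\<^bsub>M\<^esub>"
  shows "x = \<zero>\<^bsub>M\<^esub>"
proof -
  have "x = (inv s \<otimes> s) \<odot>\<^bsub>M\<^esub> x"
    using s x by (simp add: R.Units_l_inv smult_one)
  also have "\<dots> = inv s \<odot>\<^bsub>M\<^esub> (s \<odot>\<^bsub>M\<^esub> x)"
    using s x by (intro smult_assoc1) auto
  also have "\<dots> = \<zero>\<^bsub>M\<^esub>"
    using s by (simp add: eq smult_r_null)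
  finally show ?thesis .
qed

text \<open>Cancelling the annihilating unit leaves only zero. Taking \<open>L\<close> to be a mere
  subset containing zero lets the lemma apply to \<open>N \<inter> L\<close> without first showing
  that it is a submodule.\<close>

lemma (in module) u_S_torsion_iff_zero:
  assumes "S \<subseteq> Units R" "S \<noteq> {}" "L \<subseteq> carrier M" "\<zero>\<^bsub>M\<^esub> \<in> L"
  shows "u_S_torsion S (M\<lparr>carrier := L\<rparr>) \<longleftrightarrow> L = {\<zero>\<^bsub>M\<^esub>}"
proof
  assume "u_S_torsion S (M\<lparr>carrier := L\<rparr>)"
  then obtain s where "s \<in> S" "\<forall>x\<in>L. s \<odot>\<^bsub>M\<^esub> x = \<zero>\<^bsub>M\<^esub>"
    by (auto simp: u_S_torsion_def)
  then show "L = {\<zero>\<^bsub>M\<^esub>}"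
    using assms Units_smult_eq_zeroD by blast
next
  assume "L = {\<zero>\<^bsub>M\<^esub>}"
  moreover obtain s where "s \<in> S"
    using assms(2) by blast
  ultimately show "u_S_torsion S (M\<lparr>carrier := L\<rparr>)"
    using assms(1) R.Units_closed smult_r_null by (auto simp: u_S_torsion_def subset_iff intro!: bexI[of _ s])
qed

theorem mainTheorem1:
  fixes R :: "('a, 'r) ring_scheme"
    and M :: "('a, 'b, 'm) module_scheme"
    and S :: "'a set"
    and N :: "'b set"
  assumes "cring R"
    and "\<one>\<^bsub>R\<^esub> \<noteq> \<zero>\<^bsub>R\<^esub>"
    and "multiplicative_subset R S"
    and "S \<subseteq> Units R"
    and "module R M"
    and "submodule N R M"
  shows "u_S_essential R S N M \<longleftrightarrow> essential_submodule R N M"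
proof -
  interpret module R M by fact
  \<comment> \<open>The unit element of \<open>R\<close> lies in \<open>S\<close>; this supplies the
    annihilator that makes the zero module torsion.\<close>
  have "S \<noteq> {}"
    using assms(3) submonoid.one_closed by (auto simp: multiplicative_subset_def)
  note torsion_iff = u_S_torsion_iff_zero[OF assms(4) this]
  have sub: "L \<subseteq> carrier M \<and> \<zero>\<^bsub>M\<^esub> \<in> L" if "submodule L R M" for L
    using that submoduleE(1) subgroup.one_closed[of L "add_monoid M"]
    by (auto simp: submodule_def)
  have "u_S_torsion S (M\<lparr>carrier := L\<rparr>) \<longleftrightarrow> L = {\<zero>\<^bsub>M\<^esub>}"
    and "u_S_torsion S (M\<lparr>carrier := N \<inter> L\<rparr>) \<longleftrightarrow> N \<inter> L = {\<zero>\<^bsub>M\<^esub>}"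
    if "submodule L R M" for L
    using sub[OF that] sub[OF assms(6)] by (auto intro!: torsion_iff)
  then show ?thesis
    \<comment> \<open>Both equivalences hold only for submodules \<open>L\<close>;
      \<open>imp_cong\<close> makes that premise available while the conclusion is
      rewritten.\<close>
    by (simp add: u_S_essential_def essential_submodule_def cong: imp_cong)
qed

end
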